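(* Let $m\ge2$ and $p\ge m$. Assume that the sequence of knots $T$ satisfies, for all $i\in\mathbb{Z}$, the following properties: 1. for all $1\le r\le p-1$, $\ \beta_i(-r,0)\le\beta_i(-p,p)$ and $\ \beta_i(-p,-r)\le\beta_i(-r,p)$; 2. for all $1\le s\le p-1$, $\ \beta_i(-p,p)\le\beta_i(0,s)$ and $\ \beta_i(-p,s)\le\beta_i(s,p)$, where $\beta_i(u,v)$ denotes the barycenter of the $m$ weighted points $(\tau_{i,k}^{u,v},w_{i,k}^{u,v})_{1\le k\le m}$. Then, for all $i\in\mathbb{Z}$, $a_i^*$ is an optimal solution of the local minimization problem $$(\overline M_i)\qquad \min\{\Vert a\Vert_1\;:\;a\in\mathbb{R}^{2p+1},\ W_ia=b_i\}.$$ Thus the spline integral quasi-interpolant $G_p^*$ is near-best.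
   Context: $T=\{t_i\}_{i\in\mathbb{Z}}$ is a strictly increasing sequence of real knots with $|t_i|\to+\infty$ as $|i|\to+\infty$. Weighted points. For $i\in\mathbb{Z}$, integers $u<v$ and $1\le k\le m$, set $$w_{i,k}^{u,v}=t_{i-m+k+v}-t_{i-m+k+u}>0,\qquad \tau_{i,k}^{u,v}=\frac1{m+1}\Big(\sum_{j=k}^{m}t_{i-m+j+u}+\sum_{j=1}^{k}t_{i-m+j+v}\Big),$$ $$\beta_i(u,v)=\frac{\sum_{k=1}^m w_{i,k}^{u,v}\,\tau_{i,k}^{u,v}}{\sum_{k=1}^m w_{i,k}^{u,v}} .$$ Splines and moments. $B_i$ ($i\in\mathbb{Z}$) is the B-spline of degree $m$ with support $[t_{i-m},t_{i+1}]$, normalized so that $\sum_iB_i=1$. $M_i$ is the B-spline of degree $m-2$ with knots $t_{i-m+1},\ldots,t_i$, normalized by $\int_{\mathbb{R}}M_i=1$; write $\langle M_i,f\rangle=\int_{\mathbb{R}}M_if$. Set $$\theta_i=\frac1m\sum_{r=1}^m t_{i+1-r},\quad \theta_i^{(2)}=\frac{2}{m(m-1)}\sum_{1\le r<s\le m}t_{i+1-r}t_{i+1-s},\quad \mu_i^{(2)}=\frac{2}{m(m+1)}\sum_{1\le r\le s\le m}t_{i+1-r}t_{i+1-s}$$ ($\theta_i$ and $\mu_i^{(2)}$ are the first and second moments of $M_i$). Minimization problem. Vectors $a\in\mathbb{R}^{2p+1}$ are indexed as $(a(s))_{-p\le s\le p}$, and $\Vert a\Vert_1=\sum_s|a(s)|$.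 $W_i\in\mathbb{R}^{3\times(2p+1)}$ is the matrix whose column of index $s$ is $(1,\theta_{i+s},\mu_{i+s}^{(2)})^T$, $-p\le s\le p$, and $b_i=(1,\theta_i,\theta_i^{(2)})^T$. The constraints $W_ia_i=b_i$ for all $i$ express that $Gf=\sum_i\big(\sum_{s=-p}^pa_i(s)\langle M_{i+s},f\rangle\big)B_i$ reproduces polynomials of degree at most $2$. The operator $G_p^*$. $a_i^*\in\mathbb{R}^{2p+1}$ is the vector with $a_i^*(s)=0$ for $s\notin\{-p,0,p\}$ whose remaining three components are the unique solution of $W_ia_i^*=b_i$, and $G_p^*f=\sum_{i\in\mathbb{Z}}\big(a_i^*(-p)\langle M_{i-p},f\rangle+a_i^*(0)\langle M_i,f\rangle+a_i^*(p)\langle M_{i+p},f\rangle\big)B_i$. Near-best. An operator $Gf=\sum_i\big(\sum_{s=-p}^pa_i(s)\langle M_{i+s},f\rangle\big)B_i$ reproducing polynomials of degree at most $2$ is called near-best if, for every $i\in\mathbb{Z}$, its coefficient vector $a_i$ is a solution of $(\overline M_i)$. *)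

theory Defs
  imports "HOL-Analysis.Analysis" "HOL-Computational_Algebra.Polynomial"
begin

text \<open>
  Cox--de Boor recursion: \<open>bspline t k j\<close> is the B-spline of degree \<open>k\<close> with the knots
  \<open>t j, \<dots>, t (j + k + 1)\<close>. For strictly increasing \<open>t\<close> no denominator vanishes, and for each
  fixed degree this is the normalization in which the B-splines sum to 1.
\<close>
primrec bspline :: "(int \<Rightarrow> real) \<Rightarrow> nat \<Rightarrow> int \<Rightarrow> real \<Rightarrow> real" where
  "bspline t 0 j x = indicator {t j..<t (j + 1)} x"
| "bspline t (Suc k) j x =
     (x - t j) / (t (j + int k + 1) - t j) * bspline t k j x
   + (t (j + int k + 2) - x) / (t (j + int k + 2) - t (j + 1)) * bspline t k (j + 1) x"

text \<open>\<open>B m t i\<close> has the knots \<open>t (i - m), \<dots>, t (i + 1)\<close>.\<close>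
definition B :: "nat \<Rightarrow> (int \<Rightarrow> real) \<Rightarrow> int \<Rightarrow> real \<Rightarrow> real" where
  "B m t i = bspline t m (i - int m)"

text \<open>\<open>M m t i\<close> has degree \<open>m - 2\<close> and the knots \<open>t (i - m + 1), \<dots>, t i\<close>.\<close>
definition M :: "nat \<Rightarrow> (int \<Rightarrow> real) \<Rightarrow> int \<Rightarrow> real \<Rightarrow> real" where
  "M m t i x = bspline t (m - 2) (i - int m + 1) x
             / (LINT y|lebesgue. bspline t (m - 2) (i - int m + 1) y)"

definition M_functional :: "nat \<Rightarrow> (int \<Rightarrow> real) \<Rightarrow> int \<Rightarrow> (real \<Rightarrow> real) \<Rightarrow> real" where
  "M_functional m t i f = (LINT x|lebesgue. M m t i x * f x)"

definition \<theta> :: "nat \<Rightarrow> (int \<Rightarrow> real) \<Rightarrow> int \<Rightarrow> real" where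
  "\<theta> m t i = 1 / real m * (\<Sum>r=1..m. t (i + 1 - int r))"

definition \<theta>2 :: "nat \<Rightarrow> (int \<Rightarrow> real) \<Rightarrow> int \<Rightarrow> real" where
  "\<theta>2 m t i = 2 / (real m * (real m - 1)) *
     (\<Sum>s=1..m. \<Sum>r=1..<s. t (i + 1 - int r) * t (i + 1 - int s))"

definition \<mu>2 :: "nat \<Rightarrow> (int \<Rightarrow> real) \<Rightarrow> int \<Rightarrow> real" where
  "\<mu>2 m t i = 2 / (real m * (real m + 1)) *
     (\<Sum>s=1..m. \<Sum>r=1..s. t (i + 1 - int r) * t (i + 1 - int s))"

definition w :: "nat \<Rightarrow> (int \<Rightarrow> real) \<Rightarrow> int \<Rightarrow> int \<Rightarrow> int \<Rightarrow> nat \<Rightarrow> real" where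
  "w m t i u v k = t (i - int m + int k + v) - t (i - int m + int k + u)"

definition \<tau> :: "nat \<Rightarrow> (int \<Rightarrow> real) \<Rightarrow> int \<Rightarrow> int \<Rightarrow> int \<Rightarrow> nat \<Rightarrow> real" where
  "\<tau> m t i u v k = 1 / (real m + 1) *
     ((\<Sum>j=k..m. t (i - int m + int j + u)) + (\<Sum>j=1..k. t (i - int m + int j + v)))"

definition \<beta> :: "nat \<Rightarrow> (int \<Rightarrow> real) \<Rightarrow> int \<Rightarrow> int \<Rightarrow> int \<Rightarrow> real" where
  "\<beta> m t i u v = (\<Sum>k=1..m. w m t i u v k * \<tau> m t i u v k) / (\<Sum>k=1..m. w m t i u v k)"

text \<open>
  A vector with \<open>2 * p + 1\<close> components is represented by a function \<open>int \<Rightarrow> real\<close> vanishing outside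
  \<open>{-p..p}\<close>. \<open>W_col m t i s\<close> is the column of index \<open>s\<close> of the matrix \<open>W\<close> belonging to \<open>i\<close>.
\<close>
definition W_col :: "nat \<Rightarrow> (int \<Rightarrow> real) \<Rightarrow> int \<Rightarrow> int \<Rightarrow> real^3" where
  "W_col m t i s = vector [1, \<theta> m t (i + s), \<mu>2 m t (i + s)]"

definition W_mult :: "nat \<Rightarrow> (int \<Rightarrow> real) \<Rightarrow> nat \<Rightarrow> int \<Rightarrow> (int \<Rightarrow> real) \<Rightarrow> real^3" where
  "W_mult m t p i a = (\<Sum>s=-int p..int p. a s *\<^sub>R W_col m t i s)"

definition b_vec :: "nat \<Rightarrow> (int \<Rightarrow> real) \<Rightarrow> int \<Rightarrow> real^3" where
  "b_vec m t i = vector [1, \<theta> m t i, \<theta>2 m t i]"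

definition l1_norm :: "nat \<Rightarrow> (int \<Rightarrow> real) \<Rightarrow> real" where
  "l1_norm p a = (\<Sum>s=-int p..int p. \<bar>a s\<bar>)"

definition feasible :: "nat \<Rightarrow> (int \<Rightarrow> real) \<Rightarrow> nat \<Rightarrow> int \<Rightarrow> (int \<Rightarrow> real) \<Rightarrow> bool" where
  "feasible m t p i a \<longleftrightarrow>
     (\<forall>s. s \<notin> {-int p..int p} \<longrightarrow> a s = 0) \<and> W_mult m t p i a = b_vec m t i"

definition optimal :: "nat \<Rightarrow> (int \<Rightarrow> real) \<Rightarrow> nat \<Rightarrow> int \<Rightarrow> (int \<Rightarrow> real) \<Rightarrow> bool" where
  "optimal m t p i a \<longleftrightarrow> is_arg_min (l1_norm p) (feasible m t p i) a"

definition a_star :: "nat \<Rightarrow> (int \<Rightarrow> real) \<Rightarrow> nat \<Rightarrow> int \<Rightarrow> int \<Rightarrow> real" where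
  "a_star m t p i =
     (THE a. (\<forall>s. s \<notin> {-int p, 0, int p} \<longrightarrow> a s = 0) \<and> W_mult m t p i a = b_vec m t i)"

text \<open>At each point only finitely many \<open>B m t i\<close> are nonzero, so the sums over \<open>i\<close> below are finite.\<close>
definition quasi_interpolant ::
    "nat \<Rightarrow> (int \<Rightarrow> real) \<Rightarrow> nat \<Rightarrow> (int \<Rightarrow> int \<Rightarrow> real) \<Rightarrow> (real \<Rightarrow> real) \<Rightarrow> real \<Rightarrow> real" where
  "quasi_interpolant m t p a f x =
     (\<Sum>\<^sub>\<infinity>i\<in>UNIV. (\<Sum>s=-int p..int p. a i s * M_functional m t (i + s) f) * B m t i x)"

definition G_star :: "nat \<Rightarrow> (int \<Rightarrow> real) \<Rightarrow> nat \<Rightarrow> (real \<Rightarrow> real) \<Rightarrow> real \<Rightarrow> real" where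
  "G_star m t p f x =
     (\<Sum>\<^sub>\<infinity>i\<in>UNIV. (a_star m t p i (-int p) * M_functional m t (i - int p) f
                + a_star m t p i 0 * M_functional m t i f
                + a_star m t p i (int p) * M_functional m t (i + int p) f) * B m t i x)"

definition reproduces_quadratics :: "((real \<Rightarrow> real) \<Rightarrow> real \<Rightarrow> real) \<Rightarrow> bool" where
  "reproduces_quadratics G \<longleftrightarrow> (\<forall>q :: real poly. degree q \<le> 2 \<longrightarrow> G (poly q) = poly q)"

definition near_best ::
    "nat \<Rightarrow> (int \<Rightarrow> real) \<Rightarrow> nat \<Rightarrow> ((real \<Rightarrow> real) \<Rightarrow> real \<Rightarrow> real) \<Rightarrow> bool" where
  "near_best m t p G \<longleftrightarrow>
     reproduces_quadratics G \<and>
     (\<exists>a. G = quasi_interpolant m t p a \<and> (\<forall>i. optimal m t p i (a i)))"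

end

theory Submission imports Defs
begin

text \<open>
  Fix \<open>i\<close> and consider the points \<open>P s = (\<theta> (i + s), \<mu>2 (i + s))\<close> in the plane, whose abscissae
  increase with \<open>s\<close>. The number \<open>\<beta> u v\<close> is half the slope of the chord from \<open>P u\<close> to \<open>P v\<close>
  (\<open>chord_slope\<close>), so the hypotheses on \<open>\<beta>\<close> are statements about the position of these points: for
  \<open>0 < \<bar>s\<bar> < p\<close> the point \<open>P s\<close> lies on or below the chord from \<open>P (-p)\<close> to \<open>P p\<close>, and on or above
  its parallel through \<open>P 0\<close>. The point \<open>P 0\<close> itself always lies strictly below the chord
  (\<open>\<beta>_left_less_right\<close>).

  Hence there is an affine function of the plane that equals \<open>-1\<close> on the chord and \<open>1\<close> at \<open>P 0\<close>, and
  its value at every \<open>P s\<close> with \<open>\<bar>s\<bar> \<le> p\<close> lies in \<open>[-1, 1]\<close>. It is a dual certificate: the sum of its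
  values at the \<open>P s\<close> weighted by a feasible vector depends only on the right-hand side of the
  constraints and is at most the 1-norm of the vector (\<open>l1_norm_minimal\<close>). Equality holds for \<open>a_star\<close>
  as soon as its outer components are nonpositive and its middle one is nonnegative. They are,
  because the target point \<open>(\<theta> i, \<theta>2 i)\<close> has the abscissa of \<open>P 0\<close> and lies on or below it
  (\<open>\<theta>2_le_\<mu>2\<close>, a form of the Cauchy--Schwarz inequality), while \<open>P 0\<close> lies strictly below the chord (\<open>a_star_unique_solution\<close>).

  That feasible coefficients reproduce quadratics rests on two facts about B-splines, both obtained
  from the Cox--de Boor recursion by induction on the degree: the moments of a B-spline are multiples
  of the complete homogeneous symmetric polynomials of its knots (\<open>bspline_moment\<close>), and the monomials
  are combinations of B-splines whose coefficients are multiples of the elementary symmetric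
  polynomials of the interior knots (\<open>marsden\<close>).
\<close>

section \<open>Symmetric polynomials of consecutive knots\<close>

text \<open>
  The complete homogeneous symmetric polynomial of degree \<open>r\<close> in the \<open>n\<close> consecutive knots
  \<open>t j, \<dots>, t (j + n - 1)\<close>, by splitting off the first knot.
\<close>
fun hsym :: "(int \<Rightarrow> real) \<Rightarrow> nat \<Rightarrow> int \<Rightarrow> nat \<Rightarrow> real" where
  "hsym t 0 j n = 1"
| "hsym t (Suc r) j 0 = 0"
| "hsym t (Suc r) j (Suc n) = hsym t (Suc r) (j + 1) n + t j * hsym t r j (Suc n)"

text \<open>The elementary symmetric polynomial of degree \<open>r\<close> in the same \<open>n\<close> knots.\<close>
fun esym :: "(int \<Rightarrow> real) \<Rightarrow> nat \<Rightarrow> int \<Rightarrow> nat \<Rightarrow> real" where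
  "esym t 0 j n = 1"
| "esym t (Suc r) j 0 = 0"
| "esym t (Suc r) j (Suc n) = esym t (Suc r) (j + 1) n + t j * esym t r (j + 1) n"

lemma hsym_Suc_right:
  "hsym t (Suc r) j (Suc n) = hsym t (Suc r) j n + t (j + int n) * hsym t r j (Suc n)"
proof (induction r arbitrary: j n)
  case 0
  show ?case
  proof (induction n arbitrary: j)
    case (Suc n)
    then show ?case using Suc.IH[of "j + 1"] by (simp add: algebra_simps)
  qed simp
next
  case (Suc r)
  note outer = Suc.IH
  show ?case
  proof (induction n arbitrary: j)
    case 0
    show ?case by simp
  next
    case (Suc n)
    have "hsym t (Suc (Suc r)) j (Suc (Suc n))
        = hsym t (Suc (Suc r)) (j + 1) (Suc n) + t j * hsym t (Suc r) j (Suc (Suc n))"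
      by simp
    also have "\<dots> = hsym t (Suc (Suc r)) (j + 1) n + t j * hsym t (Suc r) j (Suc n)
        + t (j + int (Suc n)) * (hsym t (Suc r) (j + 1) (Suc n) + t j * hsym t r j (Suc (Suc n)))"
      unfolding Suc.IH outer[of j "Suc n"] by (simp add: algebra_simps del: hsym.simps)
    finally show ?case by simp
  qed
qed

text \<open>Moving the window of knots by one step gives a divided difference.\<close>
lemma hsym_diff:
  "hsym t (Suc r) (j + 1) n - hsym t (Suc r) j n = (t (j + int n) - t j) * hsym t r j (Suc n)"
  using hsym_Suc_right[of t r j n] by (simp add: algebra_simps)

lemma esym_Suc_right:
  "esym t (Suc r) j (Suc n) = esym t (Suc r) j n + t (j + int n) * esym t r j n"
proof (induction n arbitrary: r j)
  case 0
  show ?case by (cases r) simp_all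
next
  case (Suc n)
  note IH = Suc.IH[of _ "j + 1"]
  show ?case
  proof (cases r)
    case 0
    then show ?thesis
      using IH[of 0] esym.simps(3)[of t 0 j "Suc n"] esym.simps(3)[of t 0 j n]
      by (simp add: algebra_simps del: esym.simps(3))
  next
    case (Suc q)
    then show ?thesis
      using IH[of r] IH[of q] esym.simps(3)[of t _ j "Suc n"] esym.simps(3)[of t _ j n]
      by (simp add: algebra_simps del: esym.simps(3))
  qed
qed

lemma hsym_single: "hsym t r j (Suc 0) = t j ^ r"
  by (induction r) simp_all

text \<open>
  The windows below are counted downwards from \<open>t i\<close>, which is the form of the sums in the definitions
  of \<open>\<theta>\<close>, \<open>\<theta>2\<close> and \<open>\<mu>2\<close>.
\<close>
lemma hsym_1: "hsym t (Suc 0) (i + 1 - int n) n = (\<Sum>r=1..n. t (i + 1 - int r))"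
  by (induction n) (simp_all add: algebra_simps)

lemma hsym_2:
  "hsym t (Suc (Suc 0)) (i + 1 - int n) n = (\<Sum>s=1..n. \<Sum>r=1..s. t (i + 1 - int r) * t (i + 1 - int s))"
proof (induction n)
  case (Suc n)
  have "hsym t (Suc (Suc 0)) (i + 1 - int (Suc n)) (Suc n)
     = hsym t (Suc (Suc 0)) (i + 1 - int n) n + t (i + 1 - int (Suc n)) * hsym t (Suc 0) (i + 1 - int (Suc n)) (Suc n)"
    by (simp add: algebra_simps)
  then show ?case
    unfolding hsym_1 Suc.IH by (simp add: sum_distrib_left algebra_simps)
qed simp

lemma esym_1: "esym t (Suc 0) (i + 1 - int n) n = (\<Sum>r=1..n. t (i + 1 - int r))"
  by (induction n) (simp_all add: algebra_simps)

lemma esym_2: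
  "esym t (Suc (Suc 0)) (i + 1 - int n) n = (\<Sum>s=1..n. \<Sum>r=1..<s. t (i + 1 - int r) * t (i + 1 - int s))"
proof (induction n)
  case (Suc n)
  have "esym t (Suc (Suc 0)) (i + 1 - int (Suc n)) (Suc n)
     = esym t (Suc (Suc 0)) (i + 1 - int n) n + t (i + 1 - int (Suc n)) * esym t (Suc 0) (i + 1 - int n) n"
    by (simp add: algebra_simps)
  then show ?case
    unfolding esym_1 Suc.IH
    by (simp add: sum_distrib_left mult.commute atLeastLessThanSuc_atLeastAtMost)
qed simp

section \<open>B-splines: support, Marsden's identity, moments\<close>

lemma bspline_eq_0:
  assumes "strict_mono t" "x < t j \<or> t (j + int k + 1) \<le> x"
  shows "bspline t k j x = 0"
  using assms(2)
proof (induction k arbitrary: j)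
  case 0
  then show ?case by (auto simp: indicator_def)
next
  case (Suc k)
  have "t j < t (j + 1)" "t (j + int k + 1) < t (j + int k + 2)"
    using assms(1) by (auto intro: strict_monoD)
  with Suc.prems have "x < t j \<or> t (j + int k + 1) \<le> x"
    and "x < t (j + 1) \<or> t ((j + 1) + int k + 1) \<le> x"
    by (auto simp: algebra_simps)
  then show ?case using Suc.IH by (simp del: bspline.simps(1))
qed

text \<open>
  Marsden's identity, compared coefficient by coefficient. On \<open>[t n, t (n + 1))\<close> only the B-splines
  of degree \<open>k\<close> with first knot \<open>t (n - k), \<dots>, t n\<close> are nonzero.
\<close>
lemma marsden:
  assumes t: "strict_mono t" and n: "t n \<le> x" "x < t (n + 1)"
  shows "(\<Sum>j=n - int k..n. esym t r (j + 1) k * bspline t k j x) = of_nat (k choose r) * x ^ r"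
proof (induction k arbitrary: r)
  case 0
  show ?case using n by (cases r) simp_all
next
  case (Suc k)
  define c where "c j = esym t r (j + 1) (Suc k)" for j
  define d where "d j = t (j + int k + 1) - t j" for j
  have d: "d j > 0" for j
    unfolding d_def using t by (auto simp: strict_mono_less)
  let ?N = "bspline t k"
  have "(\<Sum>j=n - int (Suc k)..n. c j * bspline t (Suc k) j x) =
     (\<Sum>j=n - int (Suc k)..n. c j * (x - t j) / d j * ?N j x)
     + (\<Sum>j=n - int (Suc k)..n. c j * (t (j + int k + 2) - x) / d (j + 1) * ?N (j + 1) x)"
    by (simp add: d_def sum.distrib[symmetric] algebra_simps)
  also have "(\<Sum>j=n - int (Suc k)..n. c j * (x - t j) / d j * ?N j x)
      = (\<Sum>j=n - int k..n. c j * (x - t j) / d j * ?N j x)"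
  proof (rule sum.mono_neutral_right)
    show "\<forall>j\<in>{n - int (Suc k)..n} - {n - int k..n}. c j * (x - t j) / d j * ?N j x = 0"
    proof
      fix j assume "j \<in> {n - int (Suc k)..n} - {n - int k..n}"
      then have "j + int k + 1 = n" by auto
      then show "c j * (x - t j) / d j * ?N j x = 0"
        using bspline_eq_0[OF t, of x j k] n by simp
    qed
  qed auto
  also have "(\<Sum>j=n - int (Suc k)..n. c j * (t (j + int k + 2) - x) / d (j + 1) * ?N (j + 1) x)
      = (\<Sum>j=n - int k..n+1. c (j - 1) * (t (j + int k + 1) - x) / d j * ?N j x)"
    by (rule sum.reindex_bij_witness[of _ "\<lambda>j. j - 1" "\<lambda>j. j + 1"]) (auto simp: algebra_simps)
  \<comment> \<open>The outermost B-splines of both sums vanish at \<open>x\<close>, so that both run over the same indices.\<close>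
  also have "\<dots> = (\<Sum>j=n - int k..n. c (j - 1) * (t (j + int k + 1) - x) / d j * ?N j x)"
  proof (rule sum.mono_neutral_right)
    show "\<forall>j\<in>{n - int k..n+1} - {n - int k..n}.
        c (j - 1) * (t (j + int k + 1) - x) / d j * ?N j x = 0"
    proof
      fix j assume "j \<in> {n - int k..n+1} - {n - int k..n}"
      then have "j = n + 1" by auto
      then show "c (j - 1) * (t (j + int k + 1) - x) / d j * ?N j x = 0"
        using bspline_eq_0[OF t, of x j k] n by simp
    qed
  qed auto
  also have "(\<Sum>j=n - int k..n. c j * (x - t j) / d j * ?N j x)
      + (\<Sum>j=n - int k..n. c (j - 1) * (t (j + int k + 1) - x) / d j * ?N j x)
    = (\<Sum>j=n - int k..n. (esym t r (j + 1) k
          + (case r of 0 \<Rightarrow> 0 | Suc q \<Rightarrow> x * esym t q (j + 1) k)) * ?N j x)"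
    unfolding sum.distrib[symmetric]
  proof (rule sum.cong)
    fix j
    \<comment> \<open>\<open>c j\<close> and \<open>c (j - 1)\<close> share the knots \<open>t (j + 1), \<dots>, t (j + k)\<close>; splitting off the
       remaining one makes the left-hand side an affine interpolation in \<open>x\<close>.\<close>
    have "c j * (x - t j) + c (j - 1) * (t (j + int k + 1) - x)
      = (esym t r (j + 1) k + (case r of 0 \<Rightarrow> 0 | Suc q \<Rightarrow> x * esym t q (j + 1) k)) * d j"
    proof (cases r)
      case 0
      then show ?thesis by (simp add: c_def d_def algebra_simps)
    next
      case (Suc q)
      have "c j = esym t r (j + 1) k + t (j + int k + 1) * esym t q (j + 1) k"
        unfolding c_def Suc esym_Suc_right by (simp add: algebra_simps)
      moreover have "c (j - 1) = esym t r (j + 1) k + t j * esym t q (j + 1) k"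
        by (simp add: c_def Suc)
      ultimately show ?thesis
        by (simp add: Suc d_def algebra_simps)
    qed
    then show "c j * (x - t j) / d j * ?N j x + c (j - 1) * (t (j + int k + 1) - x) / d j * ?N j x
      = (esym t r (j + 1) k + (case r of 0 \<Rightarrow> 0 | Suc q \<Rightarrow> x * esym t q (j + 1) k)) * ?N j x"
      using d[of j] by (simp add: add_divide_distrib[symmetric] distrib_right[symmetric])
  qed simp
  also have "\<dots> = of_nat (Suc k choose r) * x ^ r"
  proof (cases r)
    case 0
    then show ?thesis using Suc.IH[of 0] by simp
  next
    case (Suc q)
    have "(\<Sum>j=n - int k..n. (esym t r (j + 1) k + x * esym t q (j + 1) k) * ?N j x)
      = (\<Sum>j=n - int k..n. esym t r (j + 1) k * ?N j x)
        + x * (\<Sum>j=n - int k..n. esym t q (j + 1) k * ?N j x)"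
      by (simp add: sum_distrib_left sum.distrib algebra_simps)
    then show ?thesis
      using Suc.IH[of r] Suc.IH[of q] by (simp add: Suc algebra_simps)
  qed
  finally show ?case by (simp only: c_def)
qed

text \<open>
  The recursion raises the degree and the exponent together, so the induction needs all exponents
  at once.
\<close>
lemma bspline_moment:
  assumes t: "strict_mono t"
  shows "has_bochner_integral lebesgue (\<lambda>x. x ^ r * bspline t k j x)
    ((t (j + int k + 1) - t j) * hsym t r j (k + 2) * (fact r * fact k / fact (r + k + 1)))"
proof (induction k arbitrary: r j)
  case 0
  have less: "t j < t (j + 1)" using t by (simp add: strict_mono_less)
  have "has_bochner_integral lborel (\<lambda>x. x ^ r * indicator {t j..t (j + 1)} x)
      (t (j + 1) ^ Suc r / Suc r - t j ^ Suc r / Suc r)"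
    using less
    by (intro has_bochner_integral_FTC_Icc_real)
      (auto intro!: derivative_eq_intros continuous_intros simp del: power_Suc)
  also have "?this \<longleftrightarrow> has_bochner_integral lborel (\<lambda>x. x ^ r * bspline t 0 j x)
      (t (j + 1) ^ Suc r / Suc r - t j ^ Suc r / Suc r)"
  proof (rule has_bochner_integral_cong_AE)
    show "AE x in lborel. x ^ r * indicator {t j..t (j + 1)} x = x ^ r * bspline t 0 j x"
      using AE_lborel_singleton[of "t (j + 1)"] by eventually_elim (auto simp: indicator_def)
  qed simp_all
  finally have "has_bochner_integral lebesgue (\<lambda>x. x ^ r * bspline t 0 j x)
      (t (j + 1) ^ Suc r / Suc r - t j ^ Suc r / Suc r)"
    by (simp add: has_bochner_integral_iff integrable_completion integral_completion)
  moreover have "t (j + 1) ^ Suc r - t j ^ Suc r = (t (j + 1) - t j) * hsym t r j 2"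
    using hsym_diff[of t r j 1] unfolding One_nat_def hsym_single by (simp add: numeral_2_eq_2)
  ultimately show ?case
    by (simp add: diff_divide_distrib[symmetric] numeral_2_eq_2 del: power_Suc bspline.simps hsym.simps)
next
  case (Suc k)
  define a b where "a = t j" and "b = t (j + int k + 2)"
  define d where "d = t (j + int k + 1) - t j"
  define d' where "d' = t (j + int k + 2) - t (j + 1)"
  define C :: real where "C = fact r * fact k / fact (r + k + 1)"
  define C' :: real where "C' = fact (Suc r) * fact k / fact (Suc r + k + 1)"
  have d: "d > 0" "d' > 0" unfolding d_def d'_def using t by (auto simp: strict_mono_less)
  have "has_bochner_integral lebesgue
     (\<lambda>x. (x ^ Suc r * bspline t k j x - a * (x ^ r * bspline t k j x)) / d
        + (b * (x ^ r * bspline t k (j + 1) x) - x ^ Suc r * bspline t k (j + 1) x) / d')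
     ((d * hsym t (Suc r) j (k + 2) * C' - a * (d * hsym t r j (k + 2) * C)) / d
      + (b * (d' * hsym t r (j + 1) (k + 2) * C) - d' * hsym t (Suc r) (j + 1) (k + 2) * C') / d')"
    using Suc.IH[of r j] Suc.IH[of "Suc r" j] Suc.IH[of r "j + 1"] Suc.IH[of "Suc r" "j + 1"]
    unfolding d_def d'_def C_def C'_def
    by (intro has_bochner_integral_add has_bochner_integral_diff has_bochner_integral_divide
        has_bochner_integral_mult_right) (simp_all add: algebra_simps)
  also have "(\<lambda>x. (x ^ Suc r * bspline t k j x - a * (x ^ r * bspline t k j x)) / d
        + (b * (x ^ r * bspline t k (j + 1) x) - x ^ Suc r * bspline t k (j + 1) x) / d')
     = (\<lambda>x. x ^ r * bspline t (Suc k) j x)"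
    by (rule ext) (simp add: a_def b_def d_def d'_def algebra_simps diff_divide_distrib)
  also have "(d * hsym t (Suc r) j (k + 2) * C' - a * (d * hsym t r j (k + 2) * C)) / d
      + (b * (d' * hsym t r (j + 1) (k + 2) * C) - d' * hsym t (Suc r) (j + 1) (k + 2) * C') / d'
     = (b * hsym t r (j + 1) (k + 2) - a * hsym t r j (k + 2)) * C
      - (hsym t (Suc r) (j + 1) (k + 2) - hsym t (Suc r) j (k + 2)) * C'"
    using d by (simp add: field_simps)
  also have "hsym t (Suc r) (j + 1) (k + 2) - hsym t (Suc r) j (k + 2) = (b - a) * hsym t r j (k + 3)"
    using hsym_diff[of t r j "k + 2"] by (simp add: a_def b_def algebra_simps eval_nat_numeral)
  also have "b * hsym t r (j + 1) (k + 2) - a * hsym t r j (k + 2) = (b - a) * hsym t r j (k + 3)"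
    using hsym_diff[of t r j "k + 2"] hsym_Suc_right[of t r "j + 1" "k + 1"]
    by (simp add: a_def b_def algebra_simps eval_nat_numeral)
  also have "(b - a) * hsym t r j (k + 3) * C - (b - a) * hsym t r j (k + 3) * C'
     = (b - a) * hsym t r j (k + 3) * (C - C')" by (simp add: algebra_simps)
  also have "C - C' = fact r * fact (Suc k) / fact (r + Suc k + 1)"
    unfolding C_def C'_def by (simp add: divide_simps) (simp add: algebra_simps)
  finally show ?case by (simp add: a_def b_def algebra_simps eval_nat_numeral)
qed


section \<open>Chords between the points of moments\<close>

text \<open>\<open>\<mu>2\<close> and \<open>\<theta>2\<close> are most easily compared in terms of power sums of the knots.\<close>
lemma sum_ordered_pairs_le:
  fixes a :: "nat \<Rightarrow> real"
  shows "(\<Sum>s=1..n. \<Sum>r=1..s. a r * a s) = ((\<Sum>r=1..n. a r)\<^sup>2 + (\<Sum>r=1..n. (a r)\<^sup>2)) / 2"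
  by (induction n) (simp_all add: sum_distrib_right[symmetric] power2_eq_square field_simps)

lemma sum_ordered_pairs_less:
  fixes a :: "nat \<Rightarrow> real"
  shows "(\<Sum>s=1..n. \<Sum>r=1..<s. a r * a s) = ((\<Sum>r=1..n. a r)\<^sup>2 - (\<Sum>r=1..n. (a r)\<^sup>2)) / 2"
  by (induction n) (simp_all add: sum_distrib_right[symmetric] power2_eq_square field_simps
      atLeastLessThanSuc_atLeastAtMost)

text \<open>
  Replacing the \<open>x k\<close> by the \<open>y k\<close> one at a time: the \<open>k\<close>-th replacement changes the complete
  homogeneous polynomial of degree 2 by \<open>y k - x k\<close> times the sum of \<open>x k, \<dots>, x n, y 1, \<dots>, y k\<close>.
\<close>
lemma sum_square_exchange:
  fixes x y :: "nat \<Rightarrow> real"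
  shows "2 * (\<Sum>k=1..n. (y k - x k) * ((\<Sum>j=k..n. x j) + (\<Sum>j=1..k. y j)))
    = ((\<Sum>k=1..n. y k)\<^sup>2 + (\<Sum>k=1..n. (y k)\<^sup>2)) - ((\<Sum>k=1..n. x k)\<^sup>2 + (\<Sum>k=1..n. (x k)\<^sup>2))"
proof (induction n)
  case (Suc n)
  have "(\<Sum>k=1..n. (y k - x k) * ((\<Sum>j=k..Suc n. x j) + (\<Sum>j=1..k. y j)))
     = (\<Sum>k=1..n. (y k - x k) * ((\<Sum>j=k..n. x j) + (\<Sum>j=1..k. y j)) + (y k - x k) * x (Suc n))"
    by (intro sum.cong) (auto simp: algebra_simps)
  also have "\<dots> = (\<Sum>k=1..n. (y k - x k) * ((\<Sum>j=k..n. x j) + (\<Sum>j=1..k. y j)))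
      + ((\<Sum>k=1..n. y k) - (\<Sum>k=1..n. x k)) * x (Suc n)"
    by (simp only: sum.distrib sum_distrib_right[symmetric] sum_subtractf)
  finally have "(\<Sum>k=1..n. (y k - x k) * ((\<Sum>j=k..Suc n. x j) + (\<Sum>j=1..k. y j)))
      = (\<Sum>k=1..n. (y k - x k) * ((\<Sum>j=k..n. x j) + (\<Sum>j=1..k. y j)))
      + ((\<Sum>k=1..n. y k) - (\<Sum>k=1..n. x k)) * x (Suc n)" .
  then show ?case
    using Suc.IH by (simp add: power2_eq_square algebra_simps)
qed simp

lemma sum_knots_reverse:
  "(\<Sum>r=1..m. f (t (i + 1 - int r))) = (\<Sum>k=1..m. f (t (i - int m + int k)))"
  by (rule sum.reindex_bij_witness[of _ "\<lambda>k. m + 1 - k" "\<lambda>k. m + 1 - k"])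
    (auto simp: of_nat_diff algebra_simps)

lemma \<theta>_eq: "\<theta> m t i = (\<Sum>k=1..m. t (i - int m + int k)) / real m"
  using sum_knots_reverse[of "\<lambda>x. x" t i m] by (simp add: \<theta>_def)

lemma \<mu>2_eq:
  "\<mu>2 m t i = ((\<Sum>k=1..m. t (i - int m + int k))\<^sup>2 + (\<Sum>k=1..m. (t (i - int m + int k))\<^sup>2))
     / (real m * (real m + 1))"
proof -
  have "2 / A * (X / 2) = X / A" for A X :: real by simp
  then show ?thesis
    unfolding \<mu>2_def sum_ordered_pairs_le sum_knots_reverse[of "\<lambda>x. x"]
      sum_knots_reverse[of "\<lambda>x. x\<^sup>2"] .
qed

lemma \<theta>2_eq:
  "\<theta>2 m t i = ((\<Sum>k=1..m. t (i - int m + int k))\<^sup>2 - (\<Sum>k=1..m. (t (i - int m + int k))\<^sup>2))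
     / (real m * (real m - 1))"
proof -
  have "2 / A * (X / 2) = X / A" for A X :: real by simp
  then show ?thesis
    unfolding \<theta>2_def sum_ordered_pairs_less sum_knots_reverse[of "\<lambda>x. x"]
      sum_knots_reverse[of "\<lambda>x. x\<^sup>2"] .
qed

lemma \<theta>2_le_\<mu>2:
  assumes "2 \<le> m"
  shows "\<theta>2 m t i \<le> \<mu>2 m t i"
proof -
  define S where "S = (\<Sum>k=1..m. t (i - int m + int k))"
  define Q where "Q = (\<Sum>k=1..m. (t (i - int m + int k))\<^sup>2)"
  have m: "real m > 1" using assms by simp
  have SQ: "S\<^sup>2 \<le> Q * real m"
    using sum_squared_le_sum_of_squares[of "\<lambda>k. t (i - int m + int k)" "{1..m}"]
    by (simp add: S_def Q_def)
  have "(S\<^sup>2 - Q) * (real m + 1) \<le> (S\<^sup>2 + Q) * (real m - 1)"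
    using SQ by (simp add: algebra_simps)
  then have "(S\<^sup>2 - Q) / (real m - 1) \<le> (S\<^sup>2 + Q) / (real m + 1)"
    using m by (simp add: divide_simps)
  then have "(S\<^sup>2 - Q) / (real m - 1) / real m \<le> (S\<^sup>2 + Q) / (real m + 1) / real m"
    using m by (intro divide_right_mono) auto
  then show ?thesis
    by (simp add: \<theta>2_eq \<mu>2_eq S_def Q_def mult.commute)
qed

lemma \<theta>_less:
  assumes "strict_mono t" "0 < m" "u < v"
  shows "\<theta> m t u < \<theta> m t v"
proof -
  have "(\<Sum>k=1..m. t (u - int m + int k)) < (\<Sum>k=1..m. t (v - int m + int k))"
    using assms by (intro sum_strict_mono) (auto simp: strict_mono_less)
  then show ?thesis using assms by (simp add: \<theta>_eq divide_strict_right_mono)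
qed

text \<open>
  Twice the barycenter \<open>\<beta>\<close> is a difference quotient of \<open>\<mu>2\<close> with respect to \<open>\<theta>\<close>.
\<close>
lemma chord_slope:
  assumes t: "strict_mono t" and m: "0 < m" and uv: "u < v"
  shows "\<mu>2 m t (i + v) - \<mu>2 m t (i + u) = 2 * \<beta> m t i u v * (\<theta> m t (i + v) - \<theta> m t (i + u))"
proof -
  let ?x = "\<lambda>k. t (i - int m + int k + u)" and ?y = "\<lambda>k. t (i - int m + int k + v)"
  have shift: "i + u - int m + int k = i - int m + int k + u" for u k
    by simp
  have "real m * (\<theta> m t (i + v) - \<theta> m t (i + u)) = (\<Sum>k=1..m. ?y k) - (\<Sum>k=1..m. ?x k)"
    using m unfolding \<theta>_eq shift by (simp add: field_simps)
  then have sw: "(\<Sum>k=1..m. w m t i u v k) = real m * (\<theta> m t (i + v) - \<theta> m t (i + u))"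
    unfolding w_def by (simp add: sum_subtractf)
  have "(\<Sum>k=1..m. w m t i u v k * \<tau> m t i u v k)
     = (\<Sum>k=1..m. (?y k - ?x k) * ((\<Sum>j=k..m. ?x j) + (\<Sum>j=1..k. ?y j))) / (real m + 1)"
    unfolding w_def \<tau>_def by (simp add: sum_divide_distrib)
  also have "\<dots> = (\<mu>2 m t (i + v) - \<mu>2 m t (i + u)) * real m / 2"
  proof -
    have "X / (real m + 1) = (P / (real m * (real m + 1)) - Q / (real m * (real m + 1))) * real m / 2"
      if "2 * X = P - Q" for P Q X :: real
    proof -
      have "(P / (real m * (real m + 1)) - Q / (real m * (real m + 1))) * real m / 2
          = 2 * X / (real m * (real m + 1)) * real m / 2"
        by (simp only: that diff_divide_distrib)
      also have "\<dots> = X / (real m + 1)"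
        using m by (simp add: divide_simps add_pos_pos)
      finally show ?thesis by (rule sym)
    qed
    from this[OF sum_square_exchange] show ?thesis unfolding \<mu>2_eq shift .
  qed
  finally have sw\<tau>: "(\<Sum>k=1..m. w m t i u v k * \<tau> m t i u v k)
     = (\<mu>2 m t (i + v) - \<mu>2 m t (i + u)) * real m / 2" .
  have "e = 2 * (e * real m / 2 / (real m * d)) * d" if "0 < d" for d e :: real
    using that m by simp
  from this[of "\<theta> m t (i + v) - \<theta> m t (i + u)"] show ?thesis
    unfolding \<beta>_def sw sw\<tau> using \<theta>_less[OF t m] uv by simp
qed

lemma \<beta>_between:
  assumes t: "strict_mono t" and m: "0 < m" and uv: "u < v"
  shows "(\<And>k. k \<in> {1..m} \<Longrightarrow> \<tau> m t i u v k < c) \<Longrightarrow> \<beta> m t i u v < c"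
    and "(\<And>k. k \<in> {1..m} \<Longrightarrow> c < \<tau> m t i u v k) \<Longrightarrow> c < \<beta> m t i u v"
proof -
  have w: "0 < w m t i u v k" for k
    unfolding w_def using t uv by (simp add: strict_mono_less)
  then have W: "0 < (\<Sum>k=1..m. w m t i u v k)"
    using m by (intro sum_pos) auto
  show "\<beta> m t i u v < c" if "\<And>k. k \<in> {1..m} \<Longrightarrow> \<tau> m t i u v k < c"
  proof -
    have "(\<Sum>k=1..m. w m t i u v k * \<tau> m t i u v k) < (\<Sum>k=1..m. w m t i u v k * c)"
      using that w m by (intro sum_strict_mono mult_strict_left_mono) auto
    then show ?thesis
      using W by (simp add: \<beta>_def pos_divide_less_eq sum_distrib_left mult.commute)
  qed
  show "c < \<beta> m t i u v" if "\<And>k. k \<in> {1..m} \<Longrightarrow> c < \<tau> m t i u v k"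
  proof -
    have "(\<Sum>k=1..m. w m t i u v k * c) < (\<Sum>k=1..m. w m t i u v k * \<tau> m t i u v k)"
      using that w m by (intro sum_strict_mono mult_strict_left_mono) auto
    then show ?thesis
      using W by (simp add: \<beta>_def pos_less_divide_eq sum_distrib_left mult.commute)
  qed
qed

text \<open>
  For \<open>p \<ge> m\<close> the knots of the window shifted by \<open>-p\<close> lie before \<open>t i\<close> and those shifted by \<open>p\<close> lie
  after it, so that one number \<open>c\<close> separates the two families of points \<open>\<tau>\<close>.
\<close>
lemma \<beta>_left_less_right:
  assumes t: "strict_mono t" and m: "0 < m" and p: "m \<le> p"
  shows "\<beta> m t i (- int p) 0 < \<beta> m t i 0 (int p)"
proof -
  define S where "S = (\<Sum>j=1..m. t (i - int m + int j))"
  define c where "c = (S + t i) / (real m + 1)"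
  have split: "(\<Sum>j=1..m. f j) = (\<Sum>j=1..k. f j) + (\<Sum>j=Suc k..m. f j)" if "k \<in> {1..m}"
    for k and f :: "nat \<Rightarrow> real"
    using that sum.ub_add_nat[of 1 k f "m - k"] by simp
  have "\<beta> m t i (- int p) 0 < c"
  proof (rule \<beta>_between(1)[OF t m])
    fix k assume k: "k \<in> {1..m}"
    let ?v = "\<lambda>j. t (i - int m + int j)"
    have "(\<Sum>j=k..m. t (i - int m + int j + - int p)) + (\<Sum>j=1..k. t (i - int m + int j + 0))
      = t (i - int m + int k - int p) + (\<Sum>j=Suc k..m. t (i - int m + int j - int p)) + (\<Sum>j=1..k. ?v j)"
      using k by (simp add: sum.atLeast_Suc_atMost)
    also have "t (i - int m + int k - int p) < t i"
      using k p m t by (simp add: strict_mono_less)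
    also have "(\<Sum>j=Suc k..m. t (i - int m + int j - int p)) \<le> (\<Sum>j=Suc k..m. ?v j)"
      using t by (intro sum_mono) (simp add: strict_mono_less_eq)
    finally have "(\<Sum>j=k..m. t (i - int m + int j + - int p)) + (\<Sum>j=1..k. t (i - int m + int j + 0)) < S + t i"
      using split[OF k, of ?v] by (simp add: S_def)
    then show "\<tau> m t i (- int p) 0 k < c"
      by (simp add: \<tau>_def c_def divide_strict_right_mono)
  qed (use m p in simp)
  also have "c < \<beta> m t i 0 (int p)"
  proof (rule \<beta>_between(2)[OF t m])
    fix k assume k: "k \<in> {1..m}"
    let ?v = "\<lambda>j. t (i - int m + int j)"
    have split': "(\<Sum>j=1..k. f j) = (\<Sum>j=1..<k. f j) + f k" for f :: "nat \<Rightarrow> real"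
      using k by (cases k) (simp_all add: atLeastLessThanSuc_atLeastAtMost)
    have eq: "(\<Sum>j=k..m. ?v j) = ?v k + (\<Sum>j=Suc k..m. ?v j)"
      using k by (simp add: sum.atLeast_Suc_atMost)
    have "t i < t (i - int m + int k + int p)"
      using k p m t by (simp add: strict_mono_less)
    moreover have "(\<Sum>j=1..<k. ?v j) \<le> (\<Sum>j=1..<k. t (i - int m + int j + int p))"
      using t by (intro sum_mono) (simp add: strict_mono_less_eq)
    ultimately have "S + t i < (\<Sum>j=k..m. t (i - int m + int j + 0)) + (\<Sum>j=1..k. t (i - int m + int j + int p))"
      using split[OF k, of ?v] eq split'[of ?v] split'[of "\<lambda>j. t (i - int m + int j + int p)"]
      by (simp add: S_def)
    then show "c < \<tau> m t i 0 (int p) k"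
      by (simp add: \<tau>_def c_def divide_strict_right_mono)
  qed (use m p in simp)
  finally show ?thesis .
qed

section \<open>The minimization problem\<close>

text \<open>Weak duality: \<open>F s\<close> is the value of the dual certificate at the column of index \<open>s\<close>.\<close>
lemma l1_norm_minimal:
  fixes a b F :: "int \<Rightarrow> real"
  assumes F: "\<And>s. s \<in> {-int p..int p} \<Longrightarrow> \<bar>F s\<bar> \<le> 1"
    and a: "(\<Sum>s=-int p..int p. a s * F s) = l1_norm p a"
    and b: "(\<Sum>s=-int p..int p. b s * F s) = (\<Sum>s=-int p..int p. a s * F s)"
  shows "l1_norm p a \<le> l1_norm p b"
proof -
  have "l1_norm p a = (\<Sum>s=-int p..int p. b s * F s)" using a b by simp
  also have "\<dots> \<le> (\<Sum>s=-int p..int p. \<bar>b s\<bar>)"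
  proof (rule sum_mono)
    fix s assume "s \<in> {-int p..int p}"
    then have "\<bar>b s\<bar> * \<bar>F s\<bar> \<le> \<bar>b s\<bar> * 1" using F by (intro mult_left_mono) auto
    then show "b s * F s \<le> \<bar>b s\<bar>" using abs_ge_self[of "b s * F s"] by (simp add: abs_mult)
  qed
  finally show ?thesis by (simp add: l1_norm_def)
qed

lemma W_mult_eq_iff:
  "W_mult m t p i a = b_vec m t i \<longleftrightarrow>
     (\<Sum>s=-int p..int p. a s) = 1 \<and>
     (\<Sum>s=-int p..int p. a s * \<theta> m t (i + s)) = \<theta> m t i \<and>
     (\<Sum>s=-int p..int p. a s * \<mu>2 m t (i + s)) = \<theta>2 m t i"
  by (simp add: W_mult_def b_vec_def W_col_def vec_eq_iff forall_3 sum_component)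

lemma sum_three_points:
  fixes a f :: "int \<Rightarrow> real"
  assumes "0 < p" "\<And>s. s \<notin> {-int p, 0, int p} \<Longrightarrow> a s = 0"
  shows "(\<Sum>s=-int p..int p. a s * f s) = a (-int p) * f (-int p) + a 0 * f 0 + a (int p) * f (int p)"
proof -
  have "(\<Sum>s=-int p..int p. a s * f s) = (\<Sum>s\<in>{-int p, 0, int p}. a s * f s)"
    by (rule sum.mono_neutral_right) (use assms in auto)
  then show ?thesis using assms(1) by simp
qed


text \<open>
  Cramer's rule for the affine weights that represent \<open>(\<xi>0, \<zeta>)\<close> by the points \<open>(\<xi>, \<eta>)\<close>,
  \<open>(\<xi>0, \<eta>0)\<close>, \<open>(\<xi>', \<eta>')\<close>; for \<open>\<xi> < \<xi>0 < \<xi>'\<close> the determinant \<open>D\<close> is positive if and only if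
  the middle point lies strictly below the chord of the outer two.
\<close>
lemma three_point_system:
  fixes \<xi> \<xi>0 \<xi>' \<eta> \<eta>0 \<eta>' \<zeta> :: real
  defines "D \<equiv> (\<xi>0 - \<xi>) * (\<eta>' - \<eta>0) - (\<xi>' - \<xi>0) * (\<eta>0 - \<eta>)"
  assumes D: "0 < D"
  shows "\<alpha> + \<kappa> + \<gamma> = 1 \<and> \<alpha> * \<xi> + \<kappa> * \<xi>0 + \<gamma> * \<xi>' = \<xi>0 \<and> \<alpha> * \<eta> + \<kappa> * \<eta>0 + \<gamma> * \<eta>' = \<zeta> \<longleftrightarrow>
     \<alpha> = (\<zeta> - \<eta>0) * (\<xi>' - \<xi>0) / D \<and> \<gamma> = (\<zeta> - \<eta>0) * (\<xi>0 - \<xi>) / D \<and> \<kappa> = 1 - \<alpha> - \<gamma>"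
    (is "?L \<longleftrightarrow> ?R")
proof
  assume ?L
  then have \<kappa>: "\<kappa> = 1 - \<alpha> - \<gamma>" by simp
  have 1: "\<alpha> * (\<xi>0 - \<xi>) = \<gamma> * (\<xi>' - \<xi>0)"
    and 2: "\<gamma> * (\<eta>' - \<eta>0) - \<alpha> * (\<eta>0 - \<eta>) = \<zeta> - \<eta>0"
    using \<open>?L\<close> unfolding \<kappa> by (auto simp: algebra_simps)
  have "\<alpha> * D = (\<alpha> * (\<xi>0 - \<xi>)) * (\<eta>' - \<eta>0) - \<alpha> * (\<eta>0 - \<eta>) * (\<xi>' - \<xi>0)"
    by (simp add: D_def algebra_simps)
  also have "\<dots> = (\<zeta> - \<eta>0) * (\<xi>' - \<xi>0)" unfolding 1 2[symmetric] by (simp add: algebra_simps)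
  finally have \<alpha>: "\<alpha> * D = (\<zeta> - \<eta>0) * (\<xi>' - \<xi>0)" .
  have "\<gamma> * D = \<gamma> * (\<eta>' - \<eta>0) * (\<xi>0 - \<xi>) - (\<gamma> * (\<xi>' - \<xi>0)) * (\<eta>0 - \<eta>)"
    by (simp add: D_def algebra_simps)
  also have "\<dots> = (\<zeta> - \<eta>0) * (\<xi>0 - \<xi>)" unfolding 1[symmetric] 2[symmetric] by (simp add: algebra_simps)
  finally show ?R using \<alpha> \<kappa> D by (simp add: eq_divide_eq)
next
  assume R: ?R
  define c where "c = (\<zeta> - \<eta>0) / D"
  have \<alpha>: "\<alpha> = c * (\<xi>' - \<xi>0)" and \<gamma>: "\<gamma> = c * (\<xi>0 - \<xi>)" and \<kappa>: "\<kappa> = 1 - \<alpha> - \<gamma>"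
    using R by (simp_all add: c_def)
  have c: "c * D = \<zeta> - \<eta>0" using D by (simp add: c_def)
  have "\<alpha> * \<xi> + \<kappa> * \<xi>0 + \<gamma> * \<xi>' = \<xi>0" unfolding \<kappa> \<alpha> \<gamma> by (simp add: algebra_simps)
  moreover have "\<alpha> * \<eta> + \<kappa> * \<eta>0 + \<gamma> * \<eta>' = \<eta>0 + c * D"
    unfolding \<kappa> \<alpha> \<gamma> D_def by (simp add: algebra_simps)
  ultimately show ?L using c \<kappa> by simp
qed

text \<open>
  The linear system that defines \<open>a_star\<close> has exactly one solution, so that the description by \<open>THE\<close>
  is proper.
\<close>
lemma a_star_unique_solution:
  fixes i :: int
  assumes t: "strict_mono t" and m: "2 \<le> m" and p: "m \<le> p"
  defines "a \<equiv> a_star m t p i"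
  shows "\<forall>s. s \<notin> {-int p, 0, int p} \<longrightarrow> a s = 0"
    and "W_mult m t p i a = b_vec m t i"
    and "a (-int p) \<le> 0" "a (int p) \<le> 0" "0 \<le> a 0"
proof -
  have m0: "0 < m" and p0: "0 < p" using m p by auto
  define x where "x s = \<theta> m t (i + s)" for s
  define y where "y s = \<mu>2 m t (i + s)" for s
  define z where "z = \<theta>2 m t i"
  define D where "D = (x 0 - x (-int p)) * (y (int p) - y 0) - (x (int p) - x 0) * (y 0 - y (-int p))"
  define solves where "solves a \<longleftrightarrow>
      (\<forall>s. s \<notin> {-int p, 0, int p} \<longrightarrow> a s = 0) \<and> W_mult m t p i a = b_vec m t i"
    for a :: "int \<Rightarrow> real"
  have x: "x (-int p) < x 0" "x 0 < x (int p)"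
    unfolding x_def using \<theta>_less[OF t m0] p0 by auto
  have slope: "y (int p) - y 0 = 2 * \<beta> m t i 0 (int p) * (x (int p) - x 0)"
    "y 0 - y (-int p) = 2 * \<beta> m t i (-int p) 0 * (x 0 - x (-int p))"
    using chord_slope[OF t m0, of 0 "int p" i] chord_slope[OF t m0, of "-int p" 0 i] p0
    unfolding x_def y_def by auto
  have "D = 2 * (\<beta> m t i 0 (int p) - \<beta> m t i (- int p) 0) * (x 0 - x (-int p)) * (x (int p) - x 0)"
    unfolding D_def slope by (simp add: algebra_simps)
  then have D: "D > 0"
    using x \<beta>_left_less_right[OF t m0 p, of i] by simp
  have z: "z \<le> y 0" using \<theta>2_le_\<mu>2[OF m] by (simp add: z_def y_def)
  define \<alpha> where "\<alpha> = (z - y 0) * (x (int p) - x 0) / D"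
  define \<gamma> where "\<gamma> = (z - y 0) * (x 0 - x (-int p)) / D"
  have neg: "\<alpha> \<le> 0" "\<gamma> \<le> 0"
    using D x z by (auto simp: \<alpha>_def \<gamma>_def divide_le_0_iff mult_le_0_iff)
  have solves_iff: "solves a \<longleftrightarrow> (\<forall>s. s \<notin> {-int p, 0, int p} \<longrightarrow> a s = 0) \<and>
      a (-int p) = \<alpha> \<and> a (int p) = \<gamma> \<and> a 0 = 1 - \<alpha> - \<gamma>" for a
  proof (cases "\<forall>s. s \<notin> {-int p, 0, int p} \<longrightarrow> a s = 0")
    case True
    note three = sum_three_points[OF p0, of a]
    have "solves a \<longleftrightarrow> a (-int p) + a 0 + a (int p) = 1 \<and>
        a (-int p) * x (-int p) + a 0 * x 0 + a (int p) * x (int p) = x 0 \<and>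
        a (-int p) * y (-int p) + a 0 * y 0 + a (int p) * y (int p) = z"
      using True three[of "\<lambda>_. 1"] three[of x] three[of y]
      unfolding solves_def W_mult_eq_iff by (simp add: x_def y_def z_def)
    also have "\<dots> \<longleftrightarrow> a (-int p) = \<alpha> \<and> a (int p) = \<gamma> \<and> a 0 = 1 - a (-int p) - a (int p)"
      unfolding \<alpha>_def \<gamma>_def D_def by (rule three_point_system) (use D in \<open>simp add: D_def\<close>)
    finally show ?thesis using True by auto
  next
    case False
    then show ?thesis unfolding solves_def by blast
  qed
  have "\<exists>!a. solves a"
  proof
    show "solves (\<lambda>s. if s = -int p then \<alpha> else if s = int p then \<gamma> else if s = 0 then 1 - \<alpha> - \<gamma> else 0)"
      using p0 by (simp add: solves_iff)
  next
    fix a assume "solves a"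
    then show "a = (\<lambda>s. if s = -int p then \<alpha> else if s = int p then \<gamma> else if s = 0 then 1 - \<alpha> - \<gamma> else 0)"
      by (auto simp: solves_iff)
  qed
  then have "solves a"
    unfolding a_def a_star_def solves_def by (rule theI')
  then show "\<forall>s. s \<notin> {-int p, 0, int p} \<longrightarrow> a s = 0" "W_mult m t p i a = b_vec m t i"
    "a (-int p) \<le> 0" "a (int p) \<le> 0" "0 \<le> a 0"
    using neg solves_iff[of a] by (auto simp: solves_def)
qed

text \<open>If the slope increases at an intermediate point, this point lies below the chord.\<close>
lemma below_chord:
  fixes x x0 x1 y y0 y1 :: real
  assumes x: "x0 < x" "x < x1"
    and y: "y - y0 = b * (x - x0)" "y1 - y = c * (x1 - x)" "y1 - y0 = \<sigma> * (x1 - x0)"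
  shows "b \<le> c \<Longrightarrow> y \<le> y0 + \<sigma> * (x - x0)" and "b < c \<Longrightarrow> y < y0 + \<sigma> * (x - x0)"
proof -
  have "\<sigma> * (x1 - x0) = b * (x1 - x0) + (c - b) * (x1 - x)"
    using y by (simp add: algebra_simps)
  then have \<sigma>: "(\<sigma> - b) * (x1 - x0) = (c - b) * (x1 - x)" by (simp add: algebra_simps)
  show "y \<le> y0 + \<sigma> * (x - x0)" if "b \<le> c"
  proof -
    have "0 \<le> (\<sigma> - b) * (x1 - x0)" unfolding \<sigma> using that x by simp
    then have "b \<le> \<sigma>" using x by (simp add: zero_le_mult_iff)
    then have "b * (x - x0) \<le> \<sigma> * (x - x0)" using x by (intro mult_right_mono) auto
    then show ?thesis using y by simp
  qed
  show "y < y0 + \<sigma> * (x - x0)" if "b < c"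
  proof -
    have "0 < (\<sigma> - b) * (x1 - x0)" unfolding \<sigma> using that x by simp
    then have "b < \<sigma>" using x by (simp add: zero_less_mult_iff)
    then have "b * (x - x0) < \<sigma> * (x - x0)" using x by (intro mult_strict_right_mono) auto
    then show ?thesis using y by simp
  qed
qed

lemma a_star_optimal:
  assumes t: "strict_mono t" and m: "2 \<le> m" and p: "m \<le> p"
    and left: "\<And>r. 1 \<le> r \<Longrightarrow> r \<le> int p - 1 \<Longrightarrow>
       \<beta> m t i (-r) 0 \<le> \<beta> m t i (-int p) (int p) \<and>
       \<beta> m t i (-int p) (-r) \<le> \<beta> m t i (-r) (int p)"
    and right: "\<And>s. 1 \<le> s \<Longrightarrow> s \<le> int p - 1 \<Longrightarrow>
       \<beta> m t i (-int p) (int p) \<le> \<beta> m t i 0 s \<and>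
       \<beta> m t i (-int p) s \<le> \<beta> m t i s (int p)"
  shows "optimal m t p i (a_star m t p i)"
proof -
  have m0: "0 < m" and p0: "0 < p" using m p by auto
  define a where "a = a_star m t p i"
  note a = a_star_unique_solution[OF t m p, of i, folded a_def]
  define x where "x s = \<theta> m t (i + s)" for s
  define y where "y s = \<mu>2 m t (i + s)" for s
  define \<sigma> where "\<sigma> = 2 * \<beta> m t i (-int p) (int p)"
  \<comment> \<open>\<open>H\<close> is the height of the chord above the points, \<open>F\<close> the certificate: \<open>-1\<close> at the ends
     and \<open>1\<close> in the middle.\<close>
  define H where "H s = y (-int p) + \<sigma> * (x s - x (-int p)) - y s" for s
  define F where "F s = 2 * H s / H 0 - 1" for s
  have x: "x u < x v" if "u < v" for u v
    unfolding x_def using \<theta>_less[OF t m0] that by simp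
  have slope: "y v - y u = 2 * \<beta> m t i u v * (x v - x u)" if "u < v" for u v
    unfolding x_def y_def using chord_slope[OF t m0 that] .
  have ends: "H (-int p) = 0" "H (int p) = 0"
    using slope[of "-int p" "int p"] p0 by (auto simp: H_def \<sigma>_def)
  have H0: "0 < H 0"
    using below_chord(2)[OF x x slope slope, of "-int p" 0 "int p" \<sigma>] slope[of "-int p" "int p"]
      p0 \<beta>_left_less_right[OF t m0 p, of i]
    by (simp add: H_def \<sigma>_def)
  have H_nonneg: "0 \<le> H s" if s: "s \<in> {-int p..int p}" for s
  proof -
    consider "s = -int p" | "s = int p" | "s = 0" | "-int p < s" "s < 0" | "0 < s" "s < int p"
      using s by force
    then show ?thesis
    proof cases
      case 4
      then show ?thesis
        using below_chord(1)[OF x x slope slope, of "-int p" s "int p" \<sigma>] slope[of "-int p" "int p"]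
          left[of "-s"] p0 by (simp add: H_def \<sigma>_def)
    next
      case 5
      then show ?thesis
        using below_chord(1)[OF x x slope slope, of "-int p" s "int p" \<sigma>] slope[of "-int p" "int p"]
          right[of s] p0 by (simp add: H_def \<sigma>_def)
    qed (use ends H0 in auto)
  qed
  have H_le: "H s \<le> H 0" if s: "s \<in> {-int p..int p}" for s
  proof -
    consider "s = -int p" | "s = int p" | "s = 0" | "-int p < s" "s < 0" | "0 < s" "s < int p"
      using s by force
    then show ?thesis
    proof cases
      case 4
      then have "2 * \<beta> m t i s 0 * (x 0 - x s) \<le> \<sigma> * (x 0 - x s)"
        using left[of "-s"] x[of s 0] by (intro mult_right_mono) (auto simp: \<sigma>_def)
      then show ?thesis using slope[of s 0] 4 by (simp add: H_def algebra_simps)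
    next
      case 5
      then have "\<sigma> * (x s - x 0) \<le> 2 * \<beta> m t i 0 s * (x s - x 0)"
        using right[of s] x[of 0 s] by (intro mult_right_mono) (auto simp: \<sigma>_def)
      then show ?thesis using slope[of 0 s] 5 by (simp add: H_def algebra_simps)
    qed (use ends H0 in auto)
  qed
  have F_bound: "\<bar>F s\<bar> \<le> 1" if "s \<in> {-int p..int p}" for s
    using H_nonneg[OF that] H_le[OF that] H0 by (simp add: F_def abs_le_iff field_simps)
  \<comment> \<open>\<open>F\<close> is affine in \<open>x\<close> and \<open>y\<close>, so the constraints determine the weighted sum.\<close>
  have F_sum: "(\<Sum>s=-int p..int p. b s * F s)
      = (2 * (y (-int p) - \<sigma> * x (-int p)) / H 0 - 1) + 2 * \<sigma> / H 0 * \<theta> m t i - 2 / H 0 * \<theta>2 m t i"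
    if "W_mult m t p i b = b_vec m t i" for b
  proof -
    have "b s * F s = (2 * (y (-int p) - \<sigma> * x (-int p)) / H 0 - 1) * b s
        + 2 * \<sigma> / H 0 * (b s * x s) - 2 / H 0 * (b s * y s)" for s
      unfolding F_def H_def[of s] using H0 by (simp add: field_simps)
    then have "(\<Sum>s=-int p..int p. b s * F s)
      = (2 * (y (-int p) - \<sigma> * x (-int p)) / H 0 - 1) * (\<Sum>s=-int p..int p. b s)
        + 2 * \<sigma> / H 0 * (\<Sum>s=-int p..int p. b s * x s) - 2 / H 0 * (\<Sum>s=-int p..int p. b s * y s)"
      by (simp only: sum.distrib sum_subtractf sum_distrib_left)
    then show ?thesis
      using that unfolding W_mult_eq_iff x_def y_def by simp
  qed
  have "(\<Sum>s=-int p..int p. a s * F s) = l1_norm p a"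
  proof -
    have "l1_norm p a = (\<Sum>s=-int p..int p. \<bar>a s\<bar> * 1)" by (simp add: l1_norm_def)
    also have "\<dots> = - a (-int p) + a 0 - a (int p)"
      using sum_three_points[OF p0, of "\<lambda>s. \<bar>a s\<bar>" "\<lambda>_. 1"] a by simp
    also have "\<dots> = (\<Sum>s=-int p..int p. a s * F s)"
      using sum_three_points[OF p0, of a F] a(1) ends H0 by (simp add: F_def)
    finally show ?thesis by simp
  qed
  then have "l1_norm p a \<le> l1_norm p b" if "feasible m t p i b" for b
    using l1_norm_minimal[of p F a b] F_bound F_sum[OF a(2)] F_sum[of b] that
    by (simp add: feasible_def)
  moreover have "feasible m t p i a"
    using a(1,2) p0 by (auto simp: feasible_def)
  ultimately show ?thesis
    by (auto simp: optimal_def is_arg_min_def a_def[symmetric] not_less)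
qed

section \<open>Reproduction of quadratic polynomials\<close>

lemma M_moment:
  assumes t: "strict_mono t" and m: "2 \<le> m"
  shows "has_bochner_integral lebesgue (\<lambda>x. M m t i x * x ^ r)
    (hsym t r (i + 1 - int m) m * (fact r * fact (m - 1) / fact (r + m - 1)))"
proof -
  define k where "k = m - 2"
  define j where "j = i - int m + 1"
  have mk: "m = k + 2" using m by (simp add: k_def)
  have ji: "i + 1 - int m = j" by (simp add: j_def)
  define d where "d = t (j + int k + 1) - t j"
  have d: "d > 0" unfolding d_def using t by (simp add: strict_mono_less)
  have I: "(LINT y|lebesgue. bspline t k j y) = d * (fact k / fact (k + 1))"
    using bspline_moment[OF t, of 0 k j] by (simp add: has_bochner_integral_iff d_def)
  have "has_bochner_integral lebesgue
      (\<lambda>x. x ^ r * bspline t k j x / (d * (fact k / fact (k + 1))))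
      (d * hsym t r j (k + 2) * (fact r * fact k / fact (r + k + 1)) / (d * (fact k / fact (k + 1))))"
    using bspline_moment[OF t, of r k j, folded d_def] by (rule has_bochner_integral_divide_zero)
  also have "(\<lambda>x. x ^ r * bspline t k j x / (d * (fact k / fact (k + 1)))) = (\<lambda>x. M m t i x * x ^ r)"
    unfolding M_def k_def[symmetric] j_def[symmetric] I by (simp add: mult_ac)
  also have "d * hsym t r j (k + 2) * (fact r * fact k / fact (r + k + 1)) / (d * (fact k / fact (k + 1)))
     = hsym t r (i + 1 - int m) m * (fact r * fact (m - 1) / fact (r + m - 1))"
    using d unfolding ji by (simp add: mk)
  finally show ?thesis .
qed

lemma M_functional_quadratic:
  assumes t: "strict_mono t" and m: "2 \<le> m"
  shows "M_functional m t i (\<lambda>x. c0 + c1 * x + c2 * x\<^sup>2) = c0 + c1 * \<theta> m t i + c2 * \<mu>2 m t i"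
proof -
  note mom = M_moment[OF t m, of i]
  obtain k where k: "m = Suc (Suc k)" using m by (metis Suc_le_D numeral_2_eq_2 Suc_le_mono)
  have 1: "hsym t 1 (i + 1 - int m) m * (fact 1 * fact (m - 1) / fact (1 + m - 1)) = \<theta> m t i"
    unfolding \<theta>_def One_nat_def hsym_1 by (simp add: k divide_simps del: of_nat_Suc)
  have 2: "hsym t 2 (i + 1 - int m) m * (fact 2 * fact (m - 1) / fact (2 + m - 1)) = \<mu>2 m t i"
    unfolding \<mu>2_def numeral_2_eq_2 hsym_2 by (simp add: k divide_simps)
  have "has_bochner_integral lebesgue
      (\<lambda>x. c0 * (M m t i x * x ^ 0) + c1 * (M m t i x * x ^ 1) + c2 * (M m t i x * x ^ 2))
      (c0 * 1 + c1 * \<theta> m t i + c2 * \<mu>2 m t i)"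
    using mom[of 0] mom[of 1] mom[of 2] unfolding 1 2
    by (intro has_bochner_integral_add has_bochner_integral_mult_right) simp_all
  moreover have "(\<lambda>x. c0 * (M m t i x * x ^ 0) + c1 * (M m t i x * x ^ 1) + c2 * (M m t i x * x ^ 2))
      = (\<lambda>x. M m t i x * (c0 + c1 * x + c2 * x\<^sup>2))"
    by (simp add: algebra_simps)
  ultimately show ?thesis
    by (simp add: M_functional_def has_bochner_integral_iff)
qed

lemma knot_interval:
  fixes t :: "int \<Rightarrow> real"
  assumes t: "strict_mono t"
    and unbounded: "filterlim (\<lambda>i. \<bar>t i\<bar>) at_top (filtercomap (\<lambda>i::int. \<bar>i\<bar>) at_top)"
  obtains n where "t n \<le> x" "x < t (n + 1)"
proof -
  have "eventually (\<lambda>i. \<bar>x\<bar> + \<bar>t 0\<bar> < \<bar>t i\<bar>) (filtercomap (\<lambda>i::int. \<bar>i\<bar>) at_top)"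
    using unbounded by (simp add: filterlim_at_top_dense)
  then obtain N where N: "\<And>i. N \<le> \<bar>i\<bar> \<Longrightarrow> \<bar>x\<bar> + \<bar>t 0\<bar> < \<bar>t i\<bar>"
    by (auto simp: eventually_filtercomap_at_top_linorder)
  define K where "K = max N 1"
  have "t 0 < t K" "t (-K) < t 0" using t by (auto simp: K_def strict_mono_less)
  moreover have "\<bar>x\<bar> + \<bar>t 0\<bar> < \<bar>t K\<bar>" "\<bar>x\<bar> + \<bar>t 0\<bar> < \<bar>t (-K)\<bar>"
    using N[of K] N[of "-K"] by (auto simp: K_def)
  ultimately have K: "x < t K" "t (-K) < x" by linarith+
  define A where "A = {i \<in> {-K..K}. t i \<le> x}"
  have "finite A" unfolding A_def by (rule finite_subset[of _ "{-K..K}"]) auto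
  moreover have "-K \<in> A" using K by (auto simp: A_def K_def)
  ultimately have A: "finite A" "-K \<in> A" by blast+
  then have Max: "Max A \<in> A" by (intro Max_in) auto
  then have "Max A < K" using K by (force simp: A_def less_le)
  moreover have "Max A + 1 \<notin> A" using A Max_ge[of A "Max A + 1"] by auto
  ultimately have "x < t (Max A + 1)" using Max by (auto simp: A_def)
  then show ?thesis using Max that by (auto simp: A_def)
qed

lemma B_reproduces_quadratics:
  assumes t: "strict_mono t"
    and unbounded: "filterlim (\<lambda>i. \<bar>t i\<bar>) at_top (filtercomap (\<lambda>i::int. \<bar>i\<bar>) at_top)"
    and m: "2 \<le> m"
  shows "(\<Sum>\<^sub>\<infinity>i\<in>UNIV. (c0 + c1 * \<theta> m t i + c2 * \<theta>2 m t i) * B m t i x) = c0 + c1 * x + c2 * x\<^sup>2"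
proof -
  obtain n where n: "t n \<le> x" "x < t (n + 1)"
    using knot_interval[OF t unbounded] .
  let ?c = "\<lambda>i. c0 + c1 * \<theta> m t i + c2 * \<theta>2 m t i"
  have zero: "B m t i x = 0" if "i \<notin> {n..n + int m}" for i
  proof -
    have "i + 1 \<le> n \<or> n + 1 \<le> i - int m" using that by auto
    then have "t (i + 1) \<le> x \<or> x < t (i - int m)"
      using n t by (smt (verit) strict_mono_less_eq)
    then show ?thesis unfolding B_def by (intro bspline_eq_0[OF t]) (auto simp: algebra_simps)
  qed
  have "(\<Sum>\<^sub>\<infinity>i\<in>UNIV. ?c i * B m t i x) = (\<Sum>i\<in>{n..n + int m}. ?c i * B m t i x)"
    by (subst infsum_cong_neutral[where T = "{n..n + int m}"]) (use zero in auto)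
  also have "\<dots> = (\<Sum>j=n - int m..n. ?c (j + int m) * bspline t m j x)"
    unfolding B_def
    by (rule sum.reindex_bij_witness[of _ "\<lambda>j. j + int m" "\<lambda>i. i - int m"]) auto
  also have "\<dots> = (\<Sum>j=n - int m..n. c0 * (esym t 0 (j + 1) m * bspline t m j x)
      + c1 / m * (esym t 1 (j + 1) m * bspline t m j x)
      + 2 * c2 / (real m * (real m - 1)) * (esym t 2 (j + 1) m * bspline t m j x))"
  proof (rule sum.cong)
    fix j
    have "\<theta> m t (j + int m) = esym t 1 (j + 1) m / m"
      using esym_1[of t "j + int m" m] by (simp add: \<theta>_def algebra_simps)
    moreover have "\<theta>2 m t (j + int m) = 2 / (real m * (real m - 1)) * esym t 2 (j + 1) m"
      using esym_2[of t "j + int m" m] by (simp add: \<theta>2_def algebra_simps numeral_2_eq_2)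
    ultimately show "?c (j + int m) * bspline t m j x = c0 * (esym t 0 (j + 1) m * bspline t m j x)
      + c1 / m * (esym t 1 (j + 1) m * bspline t m j x)
      + 2 * c2 / (real m * (real m - 1)) * (esym t 2 (j + 1) m * bspline t m j x)"
      by (simp add: algebra_simps)
  qed simp
  also have "\<dots> = c0 * (of_nat (m choose 0) * x ^ 0) + c1 / m * (of_nat (m choose 1) * x ^ 1)
      + 2 * c2 / (real m * (real m - 1)) * (of_nat (m choose 2) * x ^ 2)"
    by (simp only: sum.distrib sum_distrib_left[symmetric] marsden[OF t n])
  also have "\<dots> = c0 + c1 * x + c2 * x\<^sup>2"
  proof -
    have "real (m choose 2) = real m * (real m - 1) / 2"
      using m by (simp add: choose_two real_of_nat_div of_nat_diff)
    then show ?thesis unfolding binomial_n_0 choose_one by (simp only:) (use m in simp)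
  qed
  finally show ?thesis .
qed

lemma quasi_interpolant_reproduces_quadratics:
  assumes t: "strict_mono t"
    and unbounded: "filterlim (\<lambda>i. \<bar>t i\<bar>) at_top (filtercomap (\<lambda>i::int. \<bar>i\<bar>) at_top)"
    and m: "2 \<le> m"
    and a: "\<And>i. W_mult m t p i (a i) = b_vec m t i"
  shows "reproduces_quadratics (quasi_interpolant m t p a)"
  unfolding reproduces_quadratics_def
proof (intro allI impI ext)
  fix q :: "real poly" and x :: real
  assume q: "degree q \<le> 2"
  define c0 c1 c2 where "c0 = coeff q 0" and "c1 = coeff q 1" and "c2 = coeff q 2"
  have q: "poly q = (\<lambda>x. c0 + c1 * x + c2 * x\<^sup>2)"
  proof
    fix x
    have "poly q x = (\<Sum>k\<le>2. coeff q k * x ^ k)"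
      unfolding poly_altdef using q by (intro sum.mono_neutral_left) (auto simp: coeff_eq_0)
    then show "poly q x = c0 + c1 * x + c2 * x\<^sup>2"
      by (simp add: numeral_2_eq_2 c0_def c1_def c2_def)
  qed
  have "(\<Sum>s=-int p..int p. a i s * M_functional m t (i + s) (poly q)) = c0 + c1 * \<theta> m t i + c2 * \<theta>2 m t i" for i
  proof -
    have "(\<Sum>s=-int p..int p. a i s * M_functional m t (i + s) (poly q))
      = (\<Sum>s=-int p..int p. c0 * a i s + c1 * (a i s * \<theta> m t (i + s)) + c2 * (a i s * \<mu>2 m t (i + s)))"
      unfolding q M_functional_quadratic[OF t m] by (simp add: algebra_simps)
    also have "\<dots> = c0 + c1 * \<theta> m t i + c2 * \<theta>2 m t i"
      using a[of i] unfolding W_mult_eq_iff by (simp only: sum.distrib sum_distrib_left[symmetric])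
    finally show ?thesis .
  qed
  then show "quasi_interpolant m t p a (poly q) x = poly q x"
    unfolding quasi_interpolant_def using B_reproduces_quadratics[OF t unbounded m] by (simp add: q)
qed

lemma G_star_eq_quasi_interpolant:
  assumes t: "strict_mono t" and m: "2 \<le> m" and p: "m \<le> p"
  shows "G_star m t p = quasi_interpolant m t p (a_star m t p)"
proof (intro ext)
  fix f x
  have "(\<Sum>s=-int p..int p. a_star m t p i s * M_functional m t (i + s) f)
     = a_star m t p i (-int p) * M_functional m t (i - int p) f
       + a_star m t p i 0 * M_functional m t i f
       + a_star m t p i (int p) * M_functional m t (i + int p) f" for i
    using sum_three_points[of p "a_star m t p i" "\<lambda>s. M_functional m t (i + s) f"]
      a_star_unique_solution(1)[OF t m p] m p by simp
  then show "G_star m t p f x = quasi_interpolant m t p (a_star m t p) f x"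
    by (simp add: G_star_def quasi_interpolant_def)
qed

theorem theorem9:
  fixes t :: "int \<Rightarrow> real" and m p :: nat
  assumes knots_mono: "strict_mono t"
    and knots_unbounded: "filterlim (\<lambda>i. \<bar>t i\<bar>) at_top (filtercomap (\<lambda>i::int. \<bar>i\<bar>) at_top)"
    and m: "2 \<le> m" and p: "m \<le> p"
    and left: "\<And>i r. 1 \<le> r \<Longrightarrow> r \<le> int p - 1 \<Longrightarrow>
       \<beta> m t i (-r) 0 \<le> \<beta> m t i (-int p) (int p) \<and>
       \<beta> m t i (-int p) (-r) \<le> \<beta> m t i (-r) (int p)"
    and right: "\<And>i s. 1 \<le> s \<Longrightarrow> s \<le> int p - 1 \<Longrightarrow>
       \<beta> m t i (-int p) (int p) \<le> \<beta> m t i 0 s \<and>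
       \<beta> m t i (-int p) s \<le> \<beta> m t i s (int p)"
  shows "(\<forall>i. optimal m t p i (a_star m t p i)) \<and> near_best m t p (G_star m t p)"
proof -
  have opt: "optimal m t p i (a_star m t p i)" for i
    using a_star_optimal[OF knots_mono m p left right] .
  moreover have "reproduces_quadratics (G_star m t p)"
    unfolding G_star_eq_quasi_interpolant[OF knots_mono m p]
    using quasi_interpolant_reproduces_quadratics[OF knots_mono knots_unbounded m]
      a_star_unique_solution(2)[OF knots_mono m p] by blast
  ultimately show ?thesis
    unfolding near_best_def using G_star_eq_quasi_interpolant[OF knots_mono m p] by blast
qed

end
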